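(* Let $T$ be a tree with finitely many initial nodes, let $d$ be a pseudo-metric on $[T]$ such that $[T]$ with its tree topology is $d$-fragmentable, and let $\varepsilon>0$. Let $\mathcal N=\{N_b: b\in[T]\}$ be a family obtained by the construction described in the context; $\mathcal N$ is a well-founded tree under containment ($M\preccurlyeq N\iff M\supseteq N$). For $M\in\mathcal N$ let $S_M$ be the set of direct successors of $M$ in $\mathcal N$ and $\widetilde M=M\setminus\bigcup_{N\in S_M}N$. Let $q\colon[T]\to\mathcal N$ be the map sending $b\in[T]$ to the unique $M\in\mathcal N$ with $b\in\widetilde M$ (the sets $\widetilde M$, $M\in\mathcal N$, form a partition of $[T]$). Then $q$ is onto, and the quotient topology on $\mathcal N$ induced by $q$ coincides with the tree topology of $\mathcal N$.
   Context: Trees. A tree is a set $T$ with a reflexive partial order $\preccurlyeq$ such that for each $t\in T$ the set $b_t=\{s\in T: s\preccurlyeq t\}$ is finite and linearly ordered. Initial nodes are the minimal elements of $T$. For non-minimal $t$, the direct predecessor of $t$ is the maximum of $b_t\setminus\{t\}$. $S_u$ denotes the set of direct successors of $u$, i.e. of those elements whose direct predecessor is $u$. A branch of $T$ is a non-empty linearly ordered subset of $T$ closed under taking direct predecessors. $[T]$ is the set of all branches. Each finite branch equals $b_t$ for a unique $t\in T$ and is identified with $t$, so that $[T]=T\cup\partial T$, where $\partial T$ is the set of infinite branches. $T$ is well-founded if $\partial T=\emptyset$ (then $[T]=T$). For $t\in T$ put $U_t=\{b\in[T]: t\in b\}$; the tree topology on $[T]$ is the topology generated by $\{U_t,\ [T]\setminus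 U_t: t\in T\}$. When $T$ has finitely many initial nodes, $[T]$ is a compact Hausdorff space. For a well-founded tree, such as $\mathcal N$, the tree topology is regarded as a topology on the tree itself. Fragmentation. $[T]$ is $d$-fragmentable if for every non-empty closed $F\subset[T]$ and every $\varepsilon>0$ there is an open $U\subset[T]$ with $U\cap F\ne\emptyset$ and $d\text{-}\mathrm{diam}(U\cap F)<\varepsilon$. For closed $F\subset[T]$, $F'_\varepsilon$ is the set of $\xi\in F$ such that $d\text{-}\mathrm{diam}(U\cap F)\ge\varepsilon$ for every open neighbourhood $U$ of $\xi$. With $\varepsilon$ fixed, put $[T]^{(0)}=[T]$, $[T]^{(\gamma+1)}=([T]^{(\gamma)})'_\varepsilon$, $[T]^{(\alpha)}=\bigcap_{\gamma<\alpha}[T]^{(\gamma)}$ for limit $\alpha$. Construction of $\mathcal N$. For $b\in[T]$ let $\alpha(b)$ be the unique ordinal $\alpha$ with $b\in[T]^{(\alpha)}\setminus[T]^{(\alpha+1)}$, and write $\alpha=\alpha(b)$. If there is $s\in b$ with $d\text{-}\mathrm{diam}(U_s\cap[T]^{(\alpha)})<\varepsilon$ (always the case if $b\in\partial T$), let $s$ be the least such element of $b$ and put $N_b=U_s$. Otherwise $b=b_t$ for some $t\in T$, and one chooses a finite non-empty $F\subset S_t$, minimal with respect to inclusion, such that $d\text{-}\mathrm{diam}\big((U_t\setminus\bigcup_{s\in F}U_s)\cap[T]^{(\alpha)}\big)<\varepsilon$, and puts $N_b=U_t\setminus\bigcup_{s\in F}U_s$ (such an $F$ exists; any fixed choice for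 each such $b$ is allowed). Finally $\mathcal N=\{N_b: b\in[T]\}$. *)

theory Defs
  imports "HOL-Analysis.Analysis"
begin

section \<open>Trees, branches and the tree topology\<close>

text \<open>A tree is given by a carrier set \<open>T\<close> and a relation \<open>le\<close>, which is only
  meaningful on \<open>T\<close>. The set \<open>below T le t\<close> is $b_t$.\<close>

definition below :: "'a set \<Rightarrow> ('a \<Rightarrow> 'a \<Rightarrow> bool) \<Rightarrow> 'a \<Rightarrow> 'a set" where
  "below T le t = {s \<in> T. le s t}"

definition is_tree :: "'a set \<Rightarrow> ('a \<Rightarrow> 'a \<Rightarrow> bool) \<Rightarrow> bool" where
  "is_tree T le \<longleftrightarrow>
     reflp_on T le \<and> antisymp_on T le \<and> transp_on T le \<and>
     (\<forall>t\<in>T. finite (below T le t) \<and> totalp_on (below T le t) le)"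

definition initial_nodes :: "'a set \<Rightarrow> ('a \<Rightarrow> 'a \<Rightarrow> bool) \<Rightarrow> 'a set" where
  "initial_nodes T le = {t \<in> T. \<forall>s\<in>T. le s t \<longrightarrow> s = t}"

definition direct_pred :: "'a set \<Rightarrow> ('a \<Rightarrow> 'a \<Rightarrow> bool) \<Rightarrow> 'a \<Rightarrow> 'a \<Rightarrow> bool" where
  "direct_pred T le u t \<longleftrightarrow>
     u \<in> below T le t - {t} \<and> (\<forall>s \<in> below T le t - {t}. le s u)"

definition direct_succs :: "'a set \<Rightarrow> ('a \<Rightarrow> 'a \<Rightarrow> bool) \<Rightarrow> 'a \<Rightarrow> 'a set" where
  "direct_succs T le u = {t \<in> T. direct_pred T le u t}"

definition is_branch :: "'a set \<Rightarrow> ('a \<Rightarrow> 'a \<Rightarrow> bool) \<Rightarrow> 'a set \<Rightarrow> bool" where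
  "is_branch T le b \<longleftrightarrow>
     b \<noteq> {} \<and> b \<subseteq> T \<and> totalp_on b le \<and> (\<forall>t\<in>b. \<forall>u. direct_pred T le u t \<longrightarrow> u \<in> b)"

definition branches :: "'a set \<Rightarrow> ('a \<Rightarrow> 'a \<Rightarrow> bool) \<Rightarrow> 'a set set" where
  "branches T le = {b. is_branch T le b}"

definition well_founded_tree :: "'a set \<Rightarrow> ('a \<Rightarrow> 'a \<Rightarrow> bool) \<Rightarrow> bool" where
  "well_founded_tree T le \<longleftrightarrow> is_tree T le \<and> {b \<in> branches T le. infinite b} = {}"

definition cone :: "'a set \<Rightarrow> ('a \<Rightarrow> 'a \<Rightarrow> bool) \<Rightarrow> 'a \<Rightarrow> 'a set set" where
  "cone T le t = {b \<in> branches T le. t \<in> b}"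

definition tree_topology :: "'a set \<Rightarrow> ('a \<Rightarrow> 'a \<Rightarrow> bool) \<Rightarrow> 'a set topology" where
  "tree_topology T le =
     topology_generated_by (cone T le ` T \<union> (\<lambda>t. branches T le - cone T le t) ` T)"

lemma topspace_tree_topology: "topspace (tree_topology T le) = branches T le"
proof -
  have "\<Union>(cone T le ` T \<union> (\<lambda>t. branches T le - cone T le t) ` T) = branches T le"
    by (auto simp: cone_def branches_def is_branch_def)
  then show ?thesis
    by (simp add: tree_topology_def)
qed

text \<open>The tree topology viewed on the nodes, through the identification of \<open>t\<close> with
  the finite branch $b_t$. For a well-founded tree this identification is a bijection
  onto the set of branches.\<close>

definition node_topology :: "'a set \<Rightarrow> ('a \<Rightarrow> 'a \<Rightarrow> bool) \<Rightarrow> 'a topology" where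
  "node_topology T le = pullback_topology T (below T le) (tree_topology T le)"


section \<open>Fragmentability\<close>

definition pseudometric_on :: "'b set \<Rightarrow> ('b \<Rightarrow> 'b \<Rightarrow> real) \<Rightarrow> bool" where
  "pseudometric_on S d \<longleftrightarrow>
     (\<forall>x\<in>S. d x x = 0) \<and> (\<forall>x\<in>S. \<forall>y\<in>S. 0 \<le> d x y \<and> d x y = d y x) \<and>
     (\<forall>x\<in>S. \<forall>y\<in>S. \<forall>z\<in>S. d x z \<le> d x y + d y z)"

text \<open>The diameter takes values in the extended non-negative reals, so that unbounded
  sets have infinite diameter and the empty set has diameter zero.\<close>

definition ddiam :: "('b \<Rightarrow> 'b \<Rightarrow> real) \<Rightarrow> 'b set \<Rightarrow> ennreal" where
  "ddiam d A = (SUP (x, y) \<in> A \<times> A. ennreal (d x y))"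

definition fragmentable :: "'b topology \<Rightarrow> ('b \<Rightarrow> 'b \<Rightarrow> real) \<Rightarrow> bool" where
  "fragmentable X d \<longleftrightarrow>
     (\<forall>F. closedin X F \<and> F \<noteq> {} \<longrightarrow>
       (\<forall>\<epsilon>::real. \<epsilon> > 0 \<longrightarrow>
         (\<exists>U. openin X U \<and> U \<inter> F \<noteq> {} \<and> ddiam d (U \<inter> F) < ennreal \<epsilon>)))"

definition frag_deriv ::
    "'b topology \<Rightarrow> ('b \<Rightarrow> 'b \<Rightarrow> real) \<Rightarrow> real \<Rightarrow> 'b set \<Rightarrow> 'b set" where
  "frag_deriv X d \<epsilon> F =
     {\<xi> \<in> F. \<forall>U. openin X U \<and> \<xi> \<in> U \<longrightarrow> ddiam d (U \<inter> F) \<ge> ennreal \<epsilon>}"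


section \<open>Ordinals indexing the transfinite derivation\<close>

text \<open>A type of ordinals that suffices for iterating the derivation on a space with
  points in \<open>'b\<close>: its elements are the ordinals below an infinite initial ordinal of
  cardinality $2^{\aleph_0 + |b|}$, where $|b|$ is the cardinality of \<open>'b\<close>. Every
  ordinal in it has a successor, and it does not inject into \<open>'b\<close>, so that a
  decreasing transfinite sequence of subsets of \<open>'b\<close> indexed by it cannot be strictly
  decreasing throughout.\<close>

typedef 'b ordinal = "UNIV :: (nat + 'b) set set" ..

instantiation ordinal :: (type) wellorder
begin

definition less_eq_ordinal :: "'a ordinal \<Rightarrow> 'a ordinal \<Rightarrow> bool" where
  "\<alpha> \<le> \<beta> \<longleftrightarrow> (Rep_ordinal \<alpha>, Rep_ordinal \<beta>) \<in> card_of (UNIV :: (nat + 'a) set set)"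

definition less_ordinal :: "'a ordinal \<Rightarrow> 'a ordinal \<Rightarrow> bool" where
  "\<alpha> < \<beta> \<longleftrightarrow> \<alpha> \<le> \<beta> \<and> \<not> \<beta> \<le> (\<alpha> :: 'a ordinal)"

instance
proof -
  let ?r = "card_of (UNIV :: (nat + 'a) set set)"
  have W: "Well_order ?r" and F: "Field ?r = UNIV"
    by (rule card_of_Well_order, rule Field_card_of)
  then have wo: "wo_rel ?r"
    by (simp add: wo_rel_def)
  note props = wo_rel.REFL[OF wo] wo_rel.TRANS[OF wo] wo_rel.ANTISYM[OF wo] wo_rel.TOTALS[OF wo]
  show "OFCLASS('a ordinal, wellorder_class)"
  proof
    fix x y z :: "'a ordinal"
    show "(x < y) = (x \<le> y \<and> \<not> y \<le> x)"
      by (simp add: less_ordinal_def)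
    show "x \<le> x"
      using props(1) F by (auto simp: less_eq_ordinal_def refl_on_def)
    show "x \<le> y \<Longrightarrow> y \<le> z \<Longrightarrow> x \<le> z"
      using props(2) by (auto simp: less_eq_ordinal_def dest: transD)
    show "x \<le> y \<Longrightarrow> y \<le> x \<Longrightarrow> x = y"
      using props(3) by (auto simp: less_eq_ordinal_def Rep_ordinal_inject dest: antisymD)
    show "x \<le> y \<or> y \<le> x"
      using props(4) F by (auto simp: less_eq_ordinal_def)
  next
    fix P :: "'a ordinal \<Rightarrow> bool" and a
    assume step: "\<And>x. (\<And>y. y < x \<Longrightarrow> P y) \<Longrightarrow> P x"
    have "P (Abs_ordinal u)" for u
    proof (induction u rule: wo_rel.well_order_induct[OF wo])
      case (1 u)
      show ?case
      proof (rule step)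
        fix y :: "'a ordinal"
        assume "y < Abs_ordinal u"
        then have "(Rep_ordinal y, u) \<in> ?r" "Rep_ordinal y \<noteq> u"
          by (auto simp: less_ordinal_def less_eq_ordinal_def Abs_ordinal_inverse)
        then have "P (Abs_ordinal (Rep_ordinal y))"
          using 1 by blast
        then show "P y"
          by (simp add: Rep_ordinal_inverse)
      qed
    qed
    from this[of "Rep_ordinal a"] show "P a"
      by (simp add: Rep_ordinal_inverse)
  qed
qed

end

lemma ordinal_not_inj: "\<not> inj (f :: 'b ordinal \<Rightarrow> 'b)"
proof
  assume "inj f"
  moreover have "inj (Abs_ordinal :: (nat + 'b) set \<Rightarrow> 'b ordinal)"
    by (rule injI) (simp add: Abs_ordinal_inject)
  ultimately have "inj (Inr \<circ> (f \<circ> Abs_ordinal) :: (nat + 'b) set \<Rightarrow> nat + 'b)"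
    by (intro inj_compose) auto
  then have "\<exists>g :: nat + 'b \<Rightarrow> (nat + 'b) set. surj g"
    by (intro exI) (rule inj_imp_surj_inv)
  then show False
    using Cantors_theorem[of "UNIV :: (nat + 'b) set"] by auto
qed

lemma ordinal_unbounded: "\<exists>\<beta>. \<alpha> < (\<beta> :: 'b ordinal)"
proof -
  let ?r = "card_of (UNIV :: (nat + 'b) set set)"
  have "infinite (UNIV :: (nat + 'b) set set)"
    by (simp add: Finite_Set.finite_set)
  then have "\<exists>v \<in> Field ?r. Rep_ordinal \<alpha> \<noteq> v \<and> (Rep_ordinal \<alpha>, v) \<in> ?r"
    by (intro infinite_Card_order_limit card_of_Card_order) (simp_all only: Field_card_of UNIV_I not_False_eq_True)
  then obtain v where "Rep_ordinal \<alpha> \<noteq> v" "(Rep_ordinal \<alpha>, v) \<in> ?r"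
    by blast
  then have "\<alpha> \<le> Abs_ordinal v" "\<alpha> \<noteq> Abs_ordinal v"
    by (auto simp: less_eq_ordinal_def Abs_ordinal_inverse)
  then show ?thesis
    by (intro exI[of _ "Abs_ordinal v"]) simp
qed

definition ord_zero :: "'b ordinal" where
  "ord_zero = (LEAST \<alpha>. True)"

definition ord_succ :: "'b ordinal \<Rightarrow> 'b ordinal" where
  "ord_succ \<gamma> = (LEAST \<beta>. \<gamma> < \<beta>)"

definition is_limit :: "'b ordinal \<Rightarrow> bool" where
  "is_limit \<alpha> \<longleftrightarrow> \<alpha> \<noteq> ord_zero \<and> \<alpha> \<notin> range ord_succ"

lemma ord_zero_le: "ord_zero \<le> \<alpha>"
  by (simp add: ord_zero_def Least_le)

lemma less_ord_succ: "\<gamma> < ord_succ \<gamma>"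
  unfolding ord_succ_def using ordinal_unbounded by (rule LeastI_ex)

lemma ord_succ_le_iff: "ord_succ \<gamma> \<le> \<beta> \<longleftrightarrow> \<gamma> < \<beta>"
  by (metis Least_le less_le_trans less_ord_succ ord_succ_def)

lemma ord_succ_inject: "ord_succ \<gamma> = ord_succ \<delta> \<longleftrightarrow> \<gamma> = \<delta>"
  by (metis less_ord_succ linorder_not_le nle_le ord_succ_le_iff)

text \<open>The value of \<open>stage X d \<epsilon>\<close> at \<open>\<alpha>\<close> is $X^{(\alpha)}$, for fixed \<open>\<epsilon>\<close>. The recursion
  equations are \<open>stage_zero\<close>, \<open>stage_succ\<close> and \<open>stage_limit\<close> below.\<close>

function stage ::
    "'b topology \<Rightarrow> ('b \<Rightarrow> 'b \<Rightarrow> real) \<Rightarrow> real \<Rightarrow> 'b ordinal \<Rightarrow> 'b set" where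
  "stage X d \<epsilon> \<alpha> =
     (if \<alpha> = ord_zero then topspace X
      else if \<alpha> \<in> range ord_succ then frag_deriv X d \<epsilon> (stage X d \<epsilon> (inv ord_succ \<alpha>))
      else (\<Inter>\<gamma>\<in>{..<\<alpha>}. stage X d \<epsilon> \<gamma>))"
  by auto
termination
proof (relation "inv_image {(\<gamma>, \<alpha>). \<gamma> < \<alpha>} (\<lambda>(X, d, \<epsilon>, \<alpha>). \<alpha>)")
  show "wf (inv_image {(\<gamma>, \<alpha> :: 'b ordinal). \<gamma> < \<alpha>} (\<lambda>(X, d, \<epsilon>, \<alpha>). \<alpha>))"
    by (intro wf_inv_image wellorder_class.wf)
qed (auto, metis f_inv_into_f less_ord_succ rangeI)

declare stage.simps [simp del]

lemma stage_zero: "stage X d \<epsilon> ord_zero = topspace X"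
  by (simp add: stage.simps)

lemma stage_succ: "stage X d \<epsilon> (ord_succ \<gamma>) = frag_deriv X d \<epsilon> (stage X d \<epsilon> \<gamma>)"
proof -
  have "ord_succ \<gamma> \<noteq> ord_zero"
    by (metis leD less_ord_succ ord_zero_le)
  moreover have "inv ord_succ (ord_succ \<gamma>) = \<gamma>"
    by (simp add: inj_def ord_succ_inject)
  ultimately show ?thesis
    by (subst stage.simps) simp
qed

lemma stage_limit: "is_limit \<alpha> \<Longrightarrow> stage X d \<epsilon> \<alpha> = (\<Inter>\<gamma>\<in>{..<\<alpha>}. stage X d \<epsilon> \<gamma>)"
  by (subst stage.simps) (simp add: is_limit_def)

text \<open>$\alpha(b)$ is the ordinal \<open>frag_rank X d \<epsilon> b\<close>; it exists and is unique by the
  lemma below.\<close>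

definition frag_rank :: "'b topology \<Rightarrow> ('b \<Rightarrow> 'b \<Rightarrow> real) \<Rightarrow> real \<Rightarrow> 'b \<Rightarrow> 'b ordinal" where
  "frag_rank X d \<epsilon> b = (THE \<alpha>. b \<in> stage X d \<epsilon> \<alpha> - stage X d \<epsilon> (ord_succ \<alpha>))"


lemma stage_antimono:
  assumes "\<alpha> \<le> \<beta>"
  shows "stage X d \<epsilon> \<beta> \<subseteq> stage X d \<epsilon> \<alpha>"
  using assms
proof (induction \<beta> rule: less_induct)
  case (less \<beta>)
  show ?case
  proof (cases "\<alpha> = \<beta>")
    case False
    with less.prems have "\<alpha> < \<beta>"
      by simp
    consider "\<beta> = ord_zero" | \<gamma> where "\<beta> = ord_succ \<gamma>" | "is_limit \<beta>"
      by (auto simp: is_limit_def)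
    then show ?thesis
    proof cases
      case 1
      then show ?thesis
        using \<open>\<alpha> < \<beta>\<close> ord_zero_le[of \<alpha>] by simp
    next
      case 2
      then have "\<gamma> < \<beta>"
        by (simp add: less_ord_succ)
      moreover have "\<alpha> \<le> \<gamma>"
        using \<open>\<alpha> < \<beta>\<close> 2 ord_succ_le_iff[of \<gamma> \<alpha>] by (simp flip: not_less)
      ultimately have "stage X d \<epsilon> \<gamma> \<subseteq> stage X d \<epsilon> \<alpha>"
        by (rule less.IH)
      then show ?thesis
        using 2 by (auto simp: stage_succ frag_deriv_def)
    next
      case 3
      then show ?thesis
        using \<open>\<alpha> < \<beta>\<close> by (auto simp: stage_limit)
    qed
  qed simp
qed

lemma closedin_frag_deriv:
  assumes "closedin X F"
  shows "closedin X (frag_deriv X d \<epsilon> F)"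
proof -
  let ?V = "\<Union>{U. openin X U \<and> ddiam d (U \<inter> F) < ennreal \<epsilon>}"
  have "frag_deriv X d \<epsilon> F = F - ?V"
    by (auto simp: frag_deriv_def not_le)
  moreover have "openin X ?V"
    by auto
  ultimately show ?thesis
    using assms by (simp add: closedin_diff)
qed

lemma closedin_stage: "closedin X (stage X d \<epsilon> \<alpha>)"
proof (induction \<alpha> rule: less_induct)
  case (less \<alpha>)
  consider "\<alpha> = ord_zero" | \<gamma> where "\<alpha> = ord_succ \<gamma>" | "is_limit \<alpha>"
    by (auto simp: is_limit_def)
  then show ?case
  proof cases
    case 1
    then show ?thesis
      by (simp add: stage_zero)
  next
    case 2
    then show ?thesis
      using closedin_frag_deriv[OF less[of \<gamma>]] less_ord_succ[of \<gamma>] by (simp add: stage_succ)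
  next
    case 3
    then have "ord_zero < \<alpha>"
      using ord_zero_le[of \<alpha>] unfolding is_limit_def by (metis le_neq_trans)
    then have "{..<\<alpha>} \<noteq> {}"
      by blast
    then show ?thesis
      unfolding stage_limit[OF 3] using less by (intro closedin_Inter) auto
  qed
qed

lemma frag_rank_ex1:
  assumes "fragmentable X d" and "\<epsilon> > 0" and "b \<in> topspace X"
  shows "\<exists>!\<alpha>. b \<in> stage X d \<epsilon> \<alpha> - stage X d \<epsilon> (ord_succ \<alpha>)"
proof -
  have drop: "frag_deriv X d \<epsilon> F \<subset> F" if "closedin X F" "F \<noteq> {}" for F
  proof -
    from assms(1) that have "\<forall>\<epsilon>::real. \<epsilon> > 0 \<longrightarrow>
        (\<exists>U. openin X U \<and> U \<inter> F \<noteq> {} \<and> ddiam d (U \<inter> F) < ennreal \<epsilon>)"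
      unfolding fragmentable_def by simp
    with assms(2) obtain U where "openin X U" "U \<inter> F \<noteq> {}" "ddiam d (U \<inter> F) < ennreal \<epsilon>"
      by blast
    then obtain \<xi> where "openin X U" "\<xi> \<in> U \<inter> F" "ddiam d (U \<inter> F) < ennreal \<epsilon>"
      by blast
    then have "\<xi> \<in> F" "\<xi> \<notin> frag_deriv X d \<epsilon> F"
      unfolding frag_deriv_def by (auto simp flip: not_less)
    then show ?thesis
      by (auto simp: frag_deriv_def)
  qed
  have "\<exists>\<alpha>. b \<notin> stage X d \<epsilon> \<alpha>"
  proof (rule ccontr)
    assume "\<not> ?thesis"
    then have "stage X d \<epsilon> (ord_succ \<alpha>) \<subset> stage X d \<epsilon> \<alpha>" for \<alpha>
      unfolding stage_succ by (intro drop closedin_stage) blast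
    then have "\<exists>f. \<forall>\<alpha>. f \<alpha> \<in> stage X d \<epsilon> \<alpha> - stage X d \<epsilon> (ord_succ \<alpha>)"
      by (intro choice) blast
    then obtain f where f: "f \<alpha> \<in> stage X d \<epsilon> \<alpha> - stage X d \<epsilon> (ord_succ \<alpha>)" for \<alpha>
      by blast
    have "f \<alpha> \<noteq> f \<beta>" if "\<alpha> < \<beta>" for \<alpha> \<beta>
      using f[of \<alpha>] f[of \<beta>] stage_antimono[of "ord_succ \<alpha>" \<beta> X d \<epsilon>] that
      by (auto simp: ord_succ_le_iff)
    then have "inj f"
      by (rule linorder_injI)
    then show False
      using ordinal_not_inj by blast
  qed
  then obtain \<beta> where \<beta>: "b \<notin> stage X d \<epsilon> \<beta>"
    and below_\<beta>: "\<And>\<gamma>. \<gamma> < \<beta> \<Longrightarrow> b \<in> stage X d \<epsilon> \<gamma>"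
    using exists_least_iff[of "\<lambda>\<alpha>. b \<notin> stage X d \<epsilon> \<alpha>"] by blast
  have "\<beta> \<noteq> ord_zero" "\<not> is_limit \<beta>"
    using \<beta> below_\<beta> assms(3) by (auto simp: stage_zero stage_limit)
  then obtain \<alpha> where "\<beta> = ord_succ \<alpha>"
    by (auto simp: is_limit_def)
  then have \<alpha>: "b \<in> stage X d \<epsilon> \<alpha> - stage X d \<epsilon> (ord_succ \<alpha>)"
    using \<beta> below_\<beta> less_ord_succ by blast
  have "\<not> \<gamma> < \<delta>" if "b \<in> stage X d \<epsilon> \<gamma> - stage X d \<epsilon> (ord_succ \<gamma>)"
    "b \<in> stage X d \<epsilon> \<delta>" for \<gamma> \<delta>
    using that stage_antimono[of "ord_succ \<gamma>" \<delta> X d \<epsilon>] by (auto simp: ord_succ_le_iff)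
  then have "\<gamma> = \<alpha>" if "b \<in> stage X d \<epsilon> \<gamma> - stage X d \<epsilon> (ord_succ \<gamma>)" for \<gamma>
    using that \<alpha> by (meson DiffD1 linorder_neqE)
  with \<alpha> show ?thesis
    by (rule ex1I)
qed


section \<open>The family of sets obtained by the construction\<close>

text \<open>\<open>small_at T le d \<epsilon> b A\<close> is the requirement $d$-diam$(A \cap [T]^{(\alpha(b))}) < \epsilon$.\<close>

definition small_at ::
    "'a set \<Rightarrow> ('a \<Rightarrow> 'a \<Rightarrow> bool) \<Rightarrow> ('a set \<Rightarrow> 'a set \<Rightarrow> real) \<Rightarrow> real \<Rightarrow> 'a set \<Rightarrow> 'a set set \<Rightarrow> bool"
  where
  "small_at T le d \<epsilon> b A \<longleftrightarrow>
     (let X = tree_topology T le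
      in ddiam d (A \<inter> stage X d \<epsilon> (frag_rank X d \<epsilon> b)) < ennreal \<epsilon>)"

definition pruned_cone :: "'a set \<Rightarrow> ('a \<Rightarrow> 'a \<Rightarrow> bool) \<Rightarrow> 'a \<Rightarrow> 'a set \<Rightarrow> 'a set set" where
  "pruned_cone T le t F = cone T le t - (\<Union>s\<in>F. cone T le s)"

definition admissible_pruning ::
    "'a set \<Rightarrow> ('a \<Rightarrow> 'a \<Rightarrow> bool) \<Rightarrow> ('a set \<Rightarrow> 'a set \<Rightarrow> real) \<Rightarrow> real \<Rightarrow> 'a \<Rightarrow> 'a set \<Rightarrow> bool" where
  "admissible_pruning T le d \<epsilon> t F \<longleftrightarrow>
     finite F \<and> F \<noteq> {} \<and> F \<subseteq> direct_succs T le t \<and>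
     small_at T le d \<epsilon> (below T le t) (pruned_cone T le t F)"

text \<open>\<open>admissible_nbhd T le d \<epsilon> b N\<close>: \<open>N\<close> is a possible value of $N_b$.\<close>

definition admissible_nbhd ::
    "'a set \<Rightarrow> ('a \<Rightarrow> 'a \<Rightarrow> bool) \<Rightarrow> ('a set \<Rightarrow> 'a set \<Rightarrow> real) \<Rightarrow> real \<Rightarrow> 'a set \<Rightarrow> 'a set set \<Rightarrow> bool"
  where
  "admissible_nbhd T le d \<epsilon> b N \<longleftrightarrow>
     (if \<exists>s\<in>b. small_at T le d \<epsilon> b (cone T le s)
      then \<exists>s\<in>b. small_at T le d \<epsilon> b (cone T le s) \<and>
             (\<forall>s'\<in>b. small_at T le d \<epsilon> b (cone T le s') \<longrightarrow> le s s') \<and>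
             N = cone T le s
      else \<exists>t\<in>T. b = below T le t \<and>
             (\<exists>F. admissible_pruning T le d \<epsilon> t F \<and>
                  (\<forall>G. G \<subset> F \<longrightarrow> \<not> admissible_pruning T le d \<epsilon> t G) \<and>
                  N = pruned_cone T le t F))"

definition contains :: "'b set \<Rightarrow> 'b set \<Rightarrow> bool" where
  "contains M N \<longleftrightarrow> M \<supseteq> N"

definition residue :: "'b set set \<Rightarrow> 'b set \<Rightarrow> 'b set" where
  "residue \<N> M = M - \<Union>(direct_succs \<N> contains M)"

definition residue_map :: "'b set set \<Rightarrow> 'b \<Rightarrow> 'b set" where
  "residue_map \<N> b = (THE M. M \<in> \<N> \<and> b \<in> residue \<N> M)"

end

theory Submission
  imports Defs
begin

text \<open>
  Every \<open>N\<^sub>b\<close> is a clopen neighbourhood of \<open>b\<close> on which the rank \<open>\<alpha>\<close> attains its maximum at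
  \<open>b\<close>, and any two members of \<open>\<N>\<close> are disjoint or nested. If \<open>N\<^sub>c\<close> is strictly contained
  in \<open>N\<^sub>b\<close>, then either the rank drops, or it stays the same while one passes from a pruned
  cone to a cone; so strict inclusion is well-founded on \<open>\<N>\<close>. Hence \<open>q(b)\<close> is the least
  member of \<open>\<N>\<close> containing \<open>b\<close>, and \<open>q(b) \<subseteq> M\<close> holds iff \<open>b \<in> M\<close>. The same
  comparison of ranks gives \<open>q(b) = N\<^sub>b\<close>, so \<open>q\<close> is onto. The preimage under \<open>q\<close> of the subbasic set
  \<open>{N. N \<subseteq> M}\<close> is \<open>M\<close>, so \<open>q\<close> is continuous; it is a quotient map because \<open>[T]\<close> is
  compact and the tree topology of \<open>\<N>\<close> is Hausdorff.
\<close>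

section \<open>Trees and their branches\<close>

locale order_tree =
  fixes T :: "'a set" and le :: "'a \<Rightarrow> 'a \<Rightarrow> bool"
  assumes is_tree: "is_tree T le"
begin

lemma le_refl: "t \<in> T \<Longrightarrow> le t t"
  using is_tree unfolding is_tree_def by (blast dest: reflp_onD)

lemma le_antisym: "s \<in> T \<Longrightarrow> t \<in> T \<Longrightarrow> le s t \<Longrightarrow> le t s \<Longrightarrow> s = t"
  using is_tree unfolding is_tree_def by (blast dest: antisymp_onD)

lemma le_trans: "r \<in> T \<Longrightarrow> s \<in> T \<Longrightarrow> t \<in> T \<Longrightarrow> le r s \<Longrightarrow> le s t \<Longrightarrow> le r t"
  using is_tree unfolding is_tree_def by (blast dest: transp_onD)

lemma finite_below: "t \<in> T \<Longrightarrow> finite (below T le t)"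
  using is_tree by (simp add: is_tree_def)

lemma mem_below: "s \<in> below T le t \<longleftrightarrow> s \<in> T \<and> le s t"
  by (simp add: below_def)

lemma below_total:
  assumes "t \<in> T" "r \<in> below T le t" "s \<in> below T le t"
  shows "le r s \<or> le s r"
proof (cases "r = s")
  case True
  then show ?thesis
    using assms by (simp add: mem_below le_refl)
next
  case False
  moreover have "totalp_on (below T le t) le"
    using is_tree \<open>t \<in> T\<close> by (simp add: is_tree_def)
  ultimately show ?thesis
    using assms(2,3) by (blast dest: totalp_onD)
qed

lemma subset_below:
  assumes "t \<in> T" "A \<subseteq> below T le t"
  shows "finite A" "transp_on A le" "totalp_on A le"
proof -
  show "finite A"
    using assms finite_below finite_subset by blast
  have "A \<subseteq> T"
    using assms(2) by (auto simp: mem_below)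
  then show "transp_on A le"
    using is_tree transp_on_subset unfolding is_tree_def by blast
  show "totalp_on A le"
    using below_total assms by (blast intro: totalp_onI)
qed

lemma below_mono:
  assumes "s \<in> T" "t \<in> T" "le s t"
  shows "below T le s \<subseteq> below T le t"
  using le_trans[OF _ assms(1,2) _ assms(3)] by (auto simp: mem_below)

text \<open>The set \<open>b_t\<close> without \<open>t\<close> is a finite chain that contains
  \<open>s\<close>, so it has a greatest element.\<close>

lemma exists_direct_pred:
  assumes "s \<in> T" "t \<in> T" "le s t" "s \<noteq> t"
  obtains u where "u \<in> T" "direct_pred T le u t" "le s u"
proof -
  let ?A = "below T le t - {t}"
  have s: "s \<in> ?A"
    using assms by (simp add: mem_below)
  obtain u where u: "u \<in> ?A" "\<forall>x\<in>?A. x \<noteq> u \<longrightarrow> le x u"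
    using Finite_Set.bex_greatest_element[of ?A le] subset_below[OF assms(2), of ?A] s by blast
  then have "\<forall>x\<in>?A. le x u"
    by (metis Diff_iff le_refl mem_below)
  then show thesis
    using that[of u] u(1) s by (auto simp: direct_pred_def mem_below)
qed

text \<open>Take the least \<open>r\<close> in the finite chain of elements strictly above
  \<open>s\<close> and below or equal to \<open>t\<close>. An element strictly below
  \<open>r\<close> is comparable with \<open>s\<close>, and by minimality of \<open>r\<close> it
  cannot lie strictly above \<open>s\<close>.\<close>

lemma exists_direct_succ:
  assumes "s \<in> T" "t \<in> T" "le s t" "s \<noteq> t"
  obtains r where "r \<in> direct_succs T le s" "le r t"
proof -
  let ?A = "{x \<in> below T le t. le s x \<and> x \<noteq> s}"
  have t: "t \<in> ?A"
    using assms by (simp add: mem_below le_refl)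
  obtain r where r: "r \<in> ?A" "\<forall>x\<in>?A. x \<noteq> r \<longrightarrow> le r x"
    using Finite_Set.bex_least_element[of ?A le] subset_below[OF assms(2), of ?A] t by blast
  have "le x s" if x: "x \<in> below T le r - {r}" for x
  proof (rule ccontr)
    assume "\<not> le x s"
    moreover have "le x s \<or> le s x"
      using below_total[of r x s] x r(1) assms(1) by (auto simp: mem_below)
    moreover have "x \<in> below T le t"
      using x r(1) le_trans[of x r t] assms(2) by (auto simp: mem_below)
    ultimately have "x \<in> ?A"
      using assms(1) le_refl by auto
    then have "le r x"
      using r(2) x by blast
    then show False
      using le_antisym[of r x] x r(1) by (auto simp: mem_below)
  qed
  then have "r \<in> direct_succs T le s"
    using r(1) assms(1) by (auto simp: direct_succs_def direct_pred_def mem_below)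
  then show thesis
    using that r(1) by (auto simp: mem_below)
qed

lemma exists_initial_node:
  assumes "t \<in> T"
  obtains r where "r \<in> initial_nodes T le" "le r t"
proof -
  obtain r where r: "r \<in> below T le t" "\<forall>x\<in>below T le t. x \<noteq> r \<longrightarrow> le r x"
    using Finite_Set.bex_least_element[of "below T le t" le] subset_below[OF assms, of "below T le t"]
      assms le_refl mem_below by blast
  have "r \<in> initial_nodes T le"
    unfolding initial_nodes_def
  proof (intro CollectI conjI ballI impI)
    fix s
    assume s: "s \<in> T" "le s r"
    then have "s \<in> below T le t"
      using r(1) le_trans[of s r t] assms by (auto simp: mem_below)
    then show "s = r"
      using r le_antisym[of s r] s by (auto simp: mem_below)
  qed (use r in \<open>simp add: mem_below\<close>)
  then show thesis
    using that r(1) by (simp add: mem_below)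
qed

lemma branch_subset: "b \<in> branches T le \<Longrightarrow> b \<subseteq> T"
  by (simp add: branches_def is_branch_def)

lemma branch_total:
  assumes "b \<in> branches T le" "s \<in> b" "t \<in> b"
  shows "le s t \<or> le t s"
  using assms branch_subset[OF assms(1)] le_refl
  unfolding branches_def is_branch_def by (blast dest: totalp_onD)

text \<open>The definition of a branch only closes it under one step down. Induction on the size of
  \<open>b_t\<close>, which shrinks at each direct predecessor, extends this to all smaller
  nodes.\<close>

lemma branch_downward_closed:
  assumes b: "b \<in> branches T le" and "t \<in> b" "s \<in> T" "le s t"
  shows "s \<in> b"
  using assms(2,4)
proof (induction "card (below T le t)" arbitrary: t rule: less_induct)
  case less
  have t: "t \<in> T"
    using less.prems branch_subset[OF b] by blast
  show ?case
  proof (cases "s = t")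
    case False
    then obtain u where u: "u \<in> T" "direct_pred T le u t" "le s u"
      using exists_direct_pred[of s t] assms(3) t less.prems by blast
    then have ut: "le u t" "u \<noteq> t"
      by (auto simp: direct_pred_def mem_below)
    have "u \<in> b"
      using b u less.prems unfolding branches_def is_branch_def by blast
    have "below T le u \<subseteq> below T le t"
      using below_mono u(1) t ut(1) by blast
    moreover have "t \<in> below T le t - below T le u"
      using le_refl[OF t] le_antisym[OF u(1) t] t ut by (auto simp: mem_below)
    ultimately have "card (below T le u) < card (below T le t)"
      using finite_below[OF t] by (intro psubset_card_mono) auto
    then show ?thesis
      using less.hyps \<open>u \<in> b\<close> u(3) by blast
  qed (use less.prems in simp)
qed

lemma branchI:
  assumes "b \<noteq> {}" "b \<subseteq> T" "\<And>s t. s \<in> b \<Longrightarrow> t \<in> b \<Longrightarrow> le s t \<or> le t s"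
    and "\<And>s t. t \<in> b \<Longrightarrow> s \<in> T \<Longrightarrow> le s t \<Longrightarrow> s \<in> b"
  shows "b \<in> branches T le"
proof -
  have "totalp_on b le"
    using assms(3) by (blast intro: totalp_onI)
  moreover have "\<forall>t\<in>b. \<forall>u. direct_pred T le u t \<longrightarrow> u \<in> b"
    using assms(4) by (auto simp: direct_pred_def mem_below)
  ultimately show ?thesis
    using assms(1,2) by (simp add: branches_def is_branch_def)
qed

lemma below_branch:
  assumes "t \<in> T"
  shows "below T le t \<in> branches T le"
proof (rule branchI)
  show "below T le t \<noteq> {}"
    using assms le_refl mem_below by blast
  show "s \<in> below T le t" if "r \<in> below T le t" "s \<in> T" "le s r" for r s
    using that assms le_trans[of s r t] by (auto simp: mem_below)
qed (use below_total assms in \<open>auto simp: mem_below\<close>)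

section \<open>Cones and pruned cones\<close>

lemma mem_cone: "b \<in> cone T le t \<longleftrightarrow> b \<in> branches T le \<and> t \<in> b"
  by (simp add: cone_def)

lemma mem_pruned_cone:
  "b \<in> pruned_cone T le t F \<longleftrightarrow> b \<in> branches T le \<and> t \<in> b \<and> b \<inter> F = {}"
  by (auto simp: pruned_cone_def cone_def)

lemma cone_eq_pruned_cone: "cone T le t = pruned_cone T le t {}"
  by (simp add: pruned_cone_def)

lemma cone_antimono: "s \<in> T \<Longrightarrow> le s t \<Longrightarrow> cone T le t \<subseteq> cone T le s"
  using branch_downward_closed by (auto simp: mem_cone)

lemma below_mem_pruned_cone:
  assumes "t \<in> T" "F \<subseteq> direct_succs T le t"
  shows "below T le t \<in> pruned_cone T le t F"
proof -
  have "f \<notin> below T le t" if "f \<in> F" for f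
    using that assms le_antisym[of t f]
    by (auto simp: direct_succs_def direct_pred_def mem_below)
  then show ?thesis
    using assms(1) below_branch le_refl by (auto simp: mem_pruned_cone mem_below)
qed

text \<open>If \<open>r\<close> were strictly below \<open>s\<close>, it would lie below the direct
  predecessor \<open>t\<close> of \<open>s\<close>, although \<open>t\<close> is strictly below
  \<open>r\<close>.\<close>

lemma direct_succs_eq_of_le:
  assumes "r \<in> direct_succs T le t" "s \<in> direct_succs T le t" "le r s"
  shows "r = s"
proof (rule ccontr)
  assume "r \<noteq> s"
  then have "le r t" "le t r" "r \<in> T" "t \<in> T" "t \<noteq> r"
    using assms by (auto simp: direct_succs_def direct_pred_def mem_below)
  then show False
    using le_antisym by blast
qed

text \<open>A branch through \<open>r\<close> contains no other direct successor of
  \<open>t\<close>, because two nodes of a branch are comparable and distinct direct successors are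
  not.\<close>

lemma cone_subset_pruned_cone:
  assumes "r \<in> direct_succs T le t" "F \<subseteq> direct_succs T le t" "r \<notin> F"
  shows "cone T le r \<subseteq> pruned_cone T le t F"
proof
  fix b
  assume "b \<in> cone T le r"
  then have b: "b \<in> branches T le" "r \<in> b"
    by (auto simp: mem_cone)
  have "t \<in> b"
    using branch_downward_closed[OF b] assms(1)
    by (auto simp: direct_succs_def direct_pred_def mem_below)
  moreover have "f \<notin> b" if "f \<in> F" for f
    using branch_total[OF b, of f] direct_succs_eq_of_le[of r t f] direct_succs_eq_of_le[of f t r]
      that assms by blast
  ultimately show "b \<in> pruned_cone T le t F"
    using b by (auto simp: mem_pruned_cone)
qed

text \<open>Let \<open>r\<close> be the direct successor of \<open>s\<close> towards
  \<open>t\<close>. The common branch \<open>b\<close> passes through \<open>r\<close>, so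
  \<open>r\<close> was not pruned, and U_t \<subseteq> U_r fits into the pruned cone at
  \<open>s\<close>.\<close>

lemma pruned_cones_nested:
  assumes "s \<in> T" "t \<in> T" "s \<noteq> t" "le s t" "F \<subseteq> direct_succs T le s"
    and "b \<in> pruned_cone T le s F" "b \<in> pruned_cone T le t G"
  shows "cone T le t \<subseteq> pruned_cone T le s F"
proof -
  obtain r where r: "r \<in> direct_succs T le s" "le r t"
    using exists_direct_succ[of s t] assms(1-4) by blast
  then have "r \<in> T"
    by (simp add: direct_succs_def)
  then have "r \<in> b"
    using branch_downward_closed[of b t r] r(2) assms(7) by (auto simp: mem_pruned_cone)
  then have "cone T le r \<subseteq> pruned_cone T le s F"
    using assms(5,6) r(1) by (intro cone_subset_pruned_cone) (auto simp: mem_pruned_cone)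
  then show ?thesis
    using cone_antimono[OF \<open>r \<in> T\<close> r(2)] by blast
qed

text \<open>A common branch makes \<open>s\<close> and \<open>t\<close> comparable, so the previous
  lemma applies in one direction or the other.\<close>

lemma pruned_cones_laminar:
  assumes "s \<in> T" "t \<in> T" "s \<noteq> t" "F \<subseteq> direct_succs T le s" "G \<subseteq> direct_succs T le t"
    and "pruned_cone T le s F \<inter> pruned_cone T le t G \<noteq> {}"
  shows "pruned_cone T le s F \<subseteq> pruned_cone T le t G \<or> pruned_cone T le t G \<subseteq> pruned_cone T le s F"
proof -
  obtain b where b: "b \<in> pruned_cone T le s F" "b \<in> pruned_cone T le t G"
    using assms(6) by blast
  then have "le s t \<or> le t s"
    using branch_total[of b s t] by (auto simp: mem_pruned_cone)
  moreover have "pruned_cone T le u H \<subseteq> cone T le u" for u H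
    by (auto simp: pruned_cone_def)
  ultimately show ?thesis
    using pruned_cones_nested[of s t F b G] pruned_cones_nested[of t s G b F] b assms by blast
qed

section \<open>The tree topology\<close>

lemma openin_cone: "t \<in> T \<Longrightarrow> openin (tree_topology T le) (cone T le t)"
  unfolding tree_topology_def by (rule topology_generated_by_Basis) blast

lemma closedin_cone:
  assumes "t \<in> T"
  shows "closedin (tree_topology T le) (cone T le t)"
proof -
  have "openin (tree_topology T le) (branches T le - cone T le t)"
    unfolding tree_topology_def by (rule topology_generated_by_Basis) (use assms in blast)
  then show ?thesis
    by (auto simp: closedin_def topspace_tree_topology mem_cone)
qed

lemma clopen_pruned_cone:
  assumes "t \<in> T" "F \<subseteq> T" "finite F"
  shows "openin (tree_topology T le) (pruned_cone T le t F)"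
    and "closedin (tree_topology T le) (pruned_cone T le t F)"
  unfolding pruned_cone_def using assms openin_cone closedin_cone
  by (auto intro!: openin_diff closedin_diff openin_Union closedin_Union)

end

text \<open>Alexander's theorem is stated for unions of finite intersections of subbasic sets,
  whereas the tree topology is generated inductively. Each of the two topologies makes the subbasic
  sets open and is the coarsest to do so, hence they agree.\<close>

lemma topology_generated_by_eq_subbase:
  "topology (arbitrary union_of (finite intersection_of (\<lambda>x. x \<in> \<B>) relative_to \<Union>\<B>)) =
   topology_generated_by \<B>" (is "?Y = ?X")
proof (rule topology_eq[THEN iffD2], intro allI iffI)
  fix S
  show "openin ?X S" if "openin ?Y S"
  proof (rule minimal_topology_subbase[OF _ _ that])
    have "openin ?X (topspace ?X)"
      by blast
    then show "openin ?X (\<Union>\<B>)"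
      by simp
  qed (rule topology_generated_by_Basis)
  assume "openin ?X S"
  then have "generate_topology_on \<B> S"
    by (rule openin_topology_generated_by)
  then show "openin ?Y S"
  proof (rule generate_topology_on_coarsest[OF istopology_openin, rotated])
    fix B
    assume "B \<in> \<B>"
    then have "(finite intersection_of (\<lambda>x. x \<in> \<B>) relative_to \<Union>\<B>) B"
      by (auto intro: relative_to_subset_inc finite_intersection_of_inc)
    then show "openin ?Y B"
      unfolding openin_subbase by (rule arbitrary_union_of_inc)
  qed
qed

text \<open>By Alexander's subbase theorem only covers by cones \<open>U\<^sub>t\<close>, \<open>t \<in> A\<close>, and complements of
  cones \<open>U\<^sub>t\<close>, \<open>t \<in> B\<close>, matter. Two incomparable elements of \<open>B\<close>, or \<open>u \<in> A\<close> and
  \<open>t \<in> B\<close> with \<open>u \<preceq> t\<close>, already give a subcover of two sets. If neither exists,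
  the branch generated by \<open>B\<close> is not covered, unless \<open>B\<close> is empty; in that case \<open>A\<close>
  contains all initial nodes.\<close>

lemma (in order_tree) compact_tree_topology:
  assumes "finite (initial_nodes T le)"
  shows "compact_space (tree_topology T le)"
proof (rule Alexander_subbase)
  let ?S = "cone T le ` T \<union> (\<lambda>t. branches T le - cone T le t) ` T"
  show "topology (arbitrary union_of (finite intersection_of (\<lambda>x. x \<in> ?S) relative_to \<Union>?S)) =
      tree_topology T le"
    unfolding tree_topology_def by (rule topology_generated_by_eq_subbase)
  fix C
  assume C: "C \<subseteq> ?S" "\<Union>C = topspace (tree_topology T le)"
  then have cover: "\<Union>C = branches T le"
    by (simp add: topspace_tree_topology)
  have suff: "\<exists>C'. finite C' \<and> C' \<subseteq> C \<and> \<Union>C' = topspace (tree_topology T le)"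
    if "finite C'" "C' \<subseteq> C" "branches T le \<subseteq> \<Union>C'" for C'
    using that cover unfolding topspace_tree_topology by (intro exI[of _ C']) blast
  define A where "A = {t \<in> T. cone T le t \<in> C}"
  define B where "B = {t \<in> T. branches T le - cone T le t \<in> C}"
  have covered: "(\<exists>t\<in>A. t \<in> b) \<or> (\<exists>t\<in>B. t \<notin> b)" if "b \<in> branches T le" for b
  proof -
    have "b \<in> \<Union>C"
      using that cover by simp
    then obtain Q where Q: "Q \<in> C" "b \<in> Q"
      by blast
    then have "Q \<in> ?S"
      using C(1) by blast
    then show ?thesis
      using Q by (auto simp: A_def B_def mem_cone)
  qed
  consider (incomparable) s t where "s \<in> B" "t \<in> B" "\<not> le s t" "\<not> le t s"
    | (above) u t where "u \<in> A" "t \<in> B" "le u t"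
    | (empty) "B = {}"
    | (chain) "B \<noteq> {}" "\<And>s t. s \<in> B \<Longrightarrow> t \<in> B \<Longrightarrow> le s t \<or> le t s"
        "\<And>u t. u \<in> A \<Longrightarrow> t \<in> B \<Longrightarrow> \<not> le u t"
    by blast
  then show "\<exists>C'. finite C' \<and> C' \<subseteq> C \<and> \<Union>C' = topspace (tree_topology T le)"
  proof cases
    case incomparable
    then have "branches T le \<subseteq> \<Union>{branches T le - cone T le s, branches T le - cone T le t}"
      using branch_total[of _ s t] by (auto simp: mem_cone)
    then show ?thesis
      by (rule suff[rotated 2]) (use incomparable in \<open>auto simp: B_def\<close>)
  next
    case above
    then have "cone T le t \<subseteq> cone T le u"
      by (intro cone_antimono) (auto simp: A_def)
    then have "branches T le \<subseteq> \<Union>{cone T le u, branches T le - cone T le t}"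
      by blast
    then show ?thesis
      by (rule suff[rotated 2]) (use above in \<open>auto simp: A_def B_def\<close>)
  next
    case empty
    have "r \<in> A" if r: "r \<in> initial_nodes T le" for r
    proof -
      have "r \<in> T" "below T le r = {r}"
        using r le_refl by (auto simp: initial_nodes_def mem_below)
      then show ?thesis
        using covered[of "below T le r"] below_branch[of r] empty by simp
    qed
    moreover have "branches T le \<subseteq> \<Union>(cone T le ` initial_nodes T le)"
    proof
      fix b
      assume b: "b \<in> branches T le"
      then obtain t where t: "t \<in> b"
        by (auto simp: branches_def is_branch_def)
      then obtain r where "r \<in> initial_nodes T le" "le r t"
        using exists_initial_node branch_subset[OF b] by blast
      then show "b \<in> \<Union>(cone T le ` initial_nodes T le)"
        using branch_downward_closed[OF b t, of r] b by (auto simp: mem_cone initial_nodes_def)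
    qed
    ultimately show ?thesis
      using assms by (intro suff[of "cone T le ` initial_nodes T le"]) (auto simp: A_def)
  next
    case chain
    let ?b = "\<Union>t\<in>B. below T le t"
    have BT: "B \<subseteq> T"
      by (auto simp: B_def)
    have "?b \<in> branches T le"
    proof (rule branchI)
      show "?b \<noteq> {}"
        using chain(1) BT le_refl mem_below by blast
      fix r s
      assume "r \<in> ?b" "s \<in> ?b"
      then obtain t u where tu: "t \<in> B" "r \<in> below T le t" "u \<in> B" "s \<in> below T le u"
        by blast
      have "below T le t \<subseteq> below T le u \<or> below T le u \<subseteq> below T le t"
        using chain(2)[OF tu(1,3)] tu(1,3) BT below_mono by blast
      then show "le r s \<or> le s r"
        using tu BT below_total[of t r s] below_total[of u r s] by blast
    next
      fix r s
      assume "r \<in> ?b" "s \<in> T" "le s r"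
      then obtain t where t: "t \<in> B" "r \<in> below T le t"
        by blast
      then have "s \<in> below T le t"
        using le_trans[of s r t] \<open>s \<in> T\<close> \<open>le s r\<close> BT by (auto simp: mem_below)
      then show "s \<in> ?b"
        using t(1) by blast
    qed (auto simp: mem_below)
    moreover have "t \<in> ?b" if "t \<in> B" for t
      using that BT le_refl by (auto simp: mem_below)
    ultimately have "\<exists>u\<in>A. u \<in> ?b"
      using covered by blast
    then show ?thesis
      using chain(3) by (auto simp: mem_below)
  qed
qed

section \<open>Laminar families of sets\<close>

text \<open>The order-theoretic properties of the family of neighbourhoods from which its tree
  structure and the map q are obtained. The last assumption is well-foundedness of strict inclusion,
  in the form of minimal members of non-empty subfamilies.\<close>

locale laminar_family =
  fixes \<N> :: "'b set set"
  assumes empty_not_mem: "{} \<notin> \<N>"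
    and laminar: "\<And>M N. M \<in> \<N> \<Longrightarrow> N \<in> \<N> \<Longrightarrow> M \<inter> N \<noteq> {} \<Longrightarrow> M \<subseteq> N \<or> N \<subseteq> M"
    and finite_supersets: "\<And>N. N \<in> \<N> \<Longrightarrow> finite {M \<in> \<N>. N \<subseteq> M}"
    and minimal_member: "\<And>\<B>. \<B> \<subseteq> \<N> \<Longrightarrow> \<B> \<noteq> {} \<Longrightarrow> \<exists>M\<in>\<B>. \<forall>N\<in>\<B>. \<not> N \<subset> M"
begin

lemma below_contains: "below \<N> contains N = {M \<in> \<N>. N \<subseteq> M}"
  by (auto simp: below_def contains_def)

text \<open>Any two supersets of a non-empty \<open>N\<close> intersect, so laminarity turns the
  predecessors of \<open>N\<close> into a chain.\<close>

sublocale order_tree \<N> contains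
proof
  have "totalp_on {M \<in> \<N>. N \<subseteq> M} contains" if "N \<in> \<N>" for N
  proof (rule totalp_onI)
    fix M M'
    assume "M \<in> {M \<in> \<N>. N \<subseteq> M}" "M' \<in> {M \<in> \<N>. N \<subseteq> M}"
    moreover have "N \<noteq> {}"
      using that empty_not_mem by blast
    ultimately show "contains M M' \<or> contains M' M"
      using laminar[of M M'] by (auto simp: contains_def)
  qed
  then show "is_tree \<N> contains"
    using finite_supersets unfolding is_tree_def below_contains
    by (auto simp: contains_def intro!: reflp_onI antisymp_onI transp_onI)
qed

text \<open>A minimal member of a branch is its least set, since branches are chains. The branch
  therefore consists of supersets of one member, of which there are finitely many.\<close>

lemma well_founded: "well_founded_tree \<N> contains"
proof -
  have "finite B" if B: "B \<in> branches \<N> contains" for B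
  proof -
    have "B \<subseteq> \<N>" "B \<noteq> {}"
      using B by (auto simp: branches_def is_branch_def)
    then obtain M where M: "M \<in> B" "\<forall>N\<in>B. \<not> N \<subset> M"
      using minimal_member by blast
    have "M \<subseteq> N" if "N \<in> B" for N
      using branch_total[OF B M(1) that] M(2) that by (auto simp: contains_def)
    then have "B \<subseteq> {N \<in> \<N>. M \<subseteq> N}"
      using \<open>B \<subseteq> \<N>\<close> by blast
    then show ?thesis
      using finite_supersets[of M] M(1) \<open>B \<subseteq> \<N>\<close> finite_subset by blast
  qed
  then show ?thesis
    using is_tree by (auto simp: well_founded_tree_def)
qed

text \<open>This describes q(b) without direct successors, as the least member containing
  \<open>b\<close>. If some \<open>N\<close> containing \<open>b\<close> did not contain
  \<open>M\<close>, it would be strictly inside \<open>M\<close>, and the direct successor of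
  \<open>M\<close> towards \<open>N\<close> would remove \<open>b\<close> from the residue.\<close>

lemma mem_residue_iff:
  assumes "M \<in> \<N>"
  shows "b \<in> residue \<N> M \<longleftrightarrow> b \<in> M \<and> (\<forall>N\<in>\<N>. b \<in> N \<longrightarrow> M \<subseteq> N)"
proof (intro iffI conjI ballI impI)
  assume b: "b \<in> residue \<N> M"
  then show "b \<in> M"
    by (simp add: residue_def)
  fix N
  assume N: "N \<in> \<N>" "b \<in> N"
  show "M \<subseteq> N"
  proof (rule ccontr)
    assume "\<not> M \<subseteq> N"
    then have "contains M N" "M \<noteq> N"
      using laminar[OF assms N(1)] N(2) \<open>b \<in> M\<close> by (auto simp: contains_def)
    then obtain R where "R \<in> direct_succs \<N> contains M" "contains R N"
      using exists_direct_succ[OF assms N(1)] by blast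
    then show False
      using b N(2) by (auto simp: residue_def contains_def)
  qed
next
  assume b: "b \<in> M \<and> (\<forall>N\<in>\<N>. b \<in> N \<longrightarrow> M \<subseteq> N)"
  have "b \<notin> N" if "N \<in> direct_succs \<N> contains M" for N
    using that b by (auto simp: direct_succs_def direct_pred_def mem_below contains_def)
  then show "b \<in> residue \<N> M"
    using b by (auto simp: residue_def)
qed

text \<open>Members containing \<open>b\<close> pairwise intersect, so a minimal one among them is
  the least.\<close>

lemma residue_ex1:
  assumes "b \<in> \<Union>\<N>"
  shows "\<exists>!M. M \<in> \<N> \<and> b \<in> residue \<N> M"
proof -
  obtain M where M: "M \<in> \<N>" "b \<in> M" "\<And>N. N \<in> \<N> \<Longrightarrow> b \<in> N \<Longrightarrow> \<not> N \<subset> M"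
    using minimal_member[of "{N \<in> \<N>. b \<in> N}"] assms by auto
  then have "M \<subseteq> N" if "N \<in> \<N>" "b \<in> N" for N
    using laminar[of M N] that by blast
  then have "b \<in> residue \<N> M"
    using M(1,2) mem_residue_iff by blast
  moreover have "N = M" if "N \<in> \<N>" "b \<in> residue \<N> N" for N
    using mem_residue_iff that M(1) \<open>b \<in> residue \<N> M\<close> by (meson subset_antisym)
  ultimately show ?thesis
    using M(1) by blast
qed

lemma residue_map_mem:
  assumes "b \<in> \<Union>\<N>"
  shows "residue_map \<N> b \<in> \<N>" "b \<in> residue \<N> (residue_map \<N> b)"
  using theI'[OF residue_ex1[OF assms]] by (simp_all add: residue_map_def)

lemma residue_map_subset_iff:
  assumes "b \<in> \<Union>\<N>" "M \<in> \<N>"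
  shows "residue_map \<N> b \<subseteq> M \<longleftrightarrow> b \<in> M"
  using residue_map_mem[OF assms(1)] mem_residue_iff[OF residue_map_mem(1)[OF assms(1)], of b] assms(2)
  by blast

section \<open>The tree topology on a laminar family and the quotient map onto it\<close>

lemma topspace_node_topology: "topspace (node_topology \<N> contains) = \<N>"
  using below_branch
  by (auto simp: node_topology_def topspace_pullback_topology topspace_tree_topology)

text \<open>The branch identified with \<open>N\<close> is its set of supersets, so it passes
  through \<open>M\<close> exactly when \<open>N\<close> \<subseteq> \<open>M\<close>. Both sets are
  thus pullbacks of subbasic open sets.\<close>

lemma clopen_node_topology:
  assumes "M \<in> \<N>"
  shows "openin (node_topology \<N> contains) {N \<in> \<N>. N \<subseteq> M}"
    and "openin (node_topology \<N> contains) {N \<in> \<N>. \<not> N \<subseteq> M}"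
proof -
  have "{N \<in> \<N>. N \<subseteq> M} = below \<N> contains -` cone \<N> contains M \<inter> \<N>"
    using assms below_branch by (auto simp: mem_cone below_contains)
  then show "openin (node_topology \<N> contains) {N \<in> \<N>. N \<subseteq> M}"
    using openin_cone[OF assms] by (auto simp: node_topology_def openin_pullback_topology)
  have "{N \<in> \<N>. \<not> N \<subseteq> M} = below \<N> contains -` (branches \<N> contains - cone \<N> contains M) \<inter> \<N>"
    using assms below_branch by (auto simp: mem_cone below_contains)
  moreover have "openin (tree_topology \<N> contains) (branches \<N> contains - cone \<N> contains M)"
    using closedin_cone[OF assms] by (simp add: closedin_def topspace_tree_topology)
  ultimately show "openin (node_topology \<N> contains) {N \<in> \<N>. \<not> N \<subseteq> M}"
    by (auto simp: node_topology_def openin_pullback_topology)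
qed

text \<open>Of two distinct members, one is not contained in the other, say \<open>N\<close> not in
  \<open>M\<close>. The subsets of \<open>M\<close> and the remaining members then separate
  them.\<close>

lemma Hausdorff_node_topology: "Hausdorff_space (node_topology \<N> contains)"
  unfolding Hausdorff_space_def topspace_node_topology
proof (intro allI impI)
  let ?X = "node_topology \<N> contains"
  have sep: "\<exists>U V. openin ?X U \<and> openin ?X V \<and> M \<in> U \<and> N \<in> V \<and> disjnt U V"
    if "M \<in> \<N>" "N \<in> \<N>" "\<not> N \<subseteq> M" for M N
    using that clopen_node_topology[of M]
    by (intro exI[of _ "{N \<in> \<N>. N \<subseteq> M}"] exI[of _ "{N \<in> \<N>. \<not> N \<subseteq> M}"]) (auto simp: disjnt_def)
  fix M N
  assume "M \<in> \<N> \<and> N \<in> \<N> \<and> M \<noteq> N"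
  then show "\<exists>U V. openin ?X U \<and> openin ?X V \<and> M \<in> U \<and> N \<in> V \<and> disjnt U V"
    using sep[of M N] sep[of N M] by (metis disjnt_sym subset_antisym)
qed

lemma quotient_map_residue_map:
  assumes X: "compact_space X" "topspace X = \<Union>\<N>"
    and clopen: "\<And>M. M \<in> \<N> \<Longrightarrow> openin X M" "\<And>M. M \<in> \<N> \<Longrightarrow> closedin X M"
    and onto: "residue_map \<N> ` topspace X = \<N>"
  shows "quotient_map X (node_topology \<N> contains) (residue_map \<N>)"
proof (rule T1_Spaces.continuous_imp_quotient_map)
  let ?q = "residue_map \<N>"
  show "continuous_map X (node_topology \<N> contains) ?q"
    unfolding node_topology_def
  proof (rule continuous_map_pullback')
    show "topspace X \<subseteq> ?q -` \<N>"
      using onto by blast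
    have branches: "(below \<N> contains \<circ> ?q) x \<in> branches \<N> contains" if "x \<in> topspace X" for x
      using that onto below_branch[of "?q x"] by auto
    have "(below \<N> contains \<circ> ?q) x \<in> cone \<N> contains M \<longleftrightarrow> x \<in> M"
      if "M \<in> \<N>" "x \<in> topspace X" for M x
      using that branches[of x] residue_map_subset_iff[of x M] X(2) by (simp add: mem_cone below_contains)
    then have preimage: "(below \<N> contains \<circ> ?q) -` cone \<N> contains M \<inter> topspace X = M"
      if "M \<in> \<N>" for M
      using that X(2) by blast
    show "continuous_map X (tree_topology \<N> contains) (below \<N> contains \<circ> ?q)"
      unfolding tree_topology_def
    proof (rule continuous_on_generated_topo)
      fix U
      assume "U \<in> cone \<N> contains ` \<N> \<union> (\<lambda>t. branches \<N> contains - cone \<N> contains t) ` \<N>"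
      then consider M where "M \<in> \<N>" "U = cone \<N> contains M"
        | M where "M \<in> \<N>" "U = branches \<N> contains - cone \<N> contains M"
        by blast
      then show "openin X ((below \<N> contains \<circ> ?q) -` U \<inter> topspace X)"
      proof cases
        case 1
        then show ?thesis
          using clopen(1) preimage by simp
      next
        case 2
        then have "(below \<N> contains \<circ> ?q) -` U \<inter> topspace X = topspace X - M"
          using preimage[of M] branches by blast
        then show ?thesis
          using clopen(2)[OF 2(1)] by (simp add: closedin_def)
      qed
    next
      show "(below \<N> contains \<circ> ?q) ` topspace X \<subseteq>
          \<Union>(cone \<N> contains ` \<N> \<union> (\<lambda>t. branches \<N> contains - cone \<N> contains t) ` \<N>)"
        using branches topspace_tree_topology[of \<N> contains]
        by (auto simp: tree_topology_def)
    qed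
  qed
qed (use X onto topspace_node_topology Hausdorff_node_topology in simp_all)

end

section \<open>The family of neighbourhoods\<close>

lemma ddiam_mono: "A \<subseteq> B \<Longrightarrow> ddiam d A \<le> ddiam d B"
  unfolding ddiam_def by (intro SUP_subset_mono) auto

locale neighbourhood_family = order_tree T le
  for T :: "'a set" and le :: "'a \<Rightarrow> 'a \<Rightarrow> bool" +
  fixes d :: "'a set \<Rightarrow> 'a set \<Rightarrow> real" and \<epsilon> :: real and Nb :: "'a set \<Rightarrow> 'a set set"
  assumes frag: "fragmentable (tree_topology T le) d"
    and \<epsilon>: "\<epsilon> > 0"
    and Nb: "\<And>b. b \<in> branches T le \<Longrightarrow> admissible_nbhd T le d \<epsilon> b (Nb b)"
begin

abbreviation X where "X \<equiv> tree_topology T le"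
abbreviation rank where "rank \<equiv> frag_rank X d \<epsilon>"
abbreviation small where "small \<equiv> small_at T le d \<epsilon>"

text \<open>The case distinction of the construction: it decides whether \<open>N_b\<close> is a
  cone or a pruned cone.\<close>

definition has_small_cone :: "'a set \<Rightarrow> bool" where
  "has_small_cone b \<longleftrightarrow> (\<exists>s\<in>b. small b (cone T le s))"

section \<open>The rank, and sets that are small at a point\<close>

lemma rank_stage:
  assumes "b \<in> branches T le"
  shows "b \<in> stage X d \<epsilon> (rank b)"
  using theI'[OF frag_rank_ex1[OF frag \<epsilon>, of b]] assms
  by (simp add: topspace_tree_topology frag_rank_def)

text \<open>Smallness at \<open>b\<close> depends on \<open>b\<close> only through its rank; this is
  what allows branches of equal rank to be compared.\<close>

lemma small_cong: "rank b = rank c \<Longrightarrow> small b A = small c A"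
  by (simp add: small_at_def)

lemma small_mono: "small b B \<Longrightarrow> A \<subseteq> B \<Longrightarrow> small b A"
  unfolding small_at_def Let_def by (meson Int_mono ddiam_mono le_less_trans subset_refl)

text \<open>A branch \<open>c\<close> of larger rank survives in the derivative of the stage at
  \<open>rank b\<close>, so every open set around \<open>c\<close> meets that stage in a set of
  diameter at least \<epsilon>.\<close>

lemma rank_le_of_small:
  assumes "small b A" "openin X A" "c \<in> A"
  shows "rank c \<le> rank b"
proof (rule ccontr)
  assume "\<not> rank c \<le> rank b"
  then have "ord_succ (rank b) \<le> rank c"
    by (simp add: ord_succ_le_iff)
  moreover have "c \<in> branches T le"
    using assms(2,3) openin_subset topspace_tree_topology by blast
  ultimately have "c \<in> frag_deriv X d \<epsilon> (stage X d \<epsilon> (rank b))"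
    using rank_stage[of c] stage_antimono[of "ord_succ (rank b)" "rank c" X d \<epsilon>]
    by (auto simp: stage_succ)
  then have "ennreal \<epsilon> \<le> ddiam d (A \<inter> stage X d \<epsilon> (rank b))"
    using assms(2,3) by (auto simp: frag_deriv_def)
  then show False
    using assms(1) by (simp add: small_at_def Let_def flip: not_less)
qed

lemma Nb_cases:
  assumes "b \<in> branches T le"
  obtains (cone) s where "has_small_cone b" "s \<in> b" "small b (cone T le s)"
      "\<And>s'. s' \<in> b \<Longrightarrow> small b (cone T le s') \<Longrightarrow> le s s'" "Nb b = cone T le s"
  | (pruned) t F where "\<not> has_small_cone b" "t \<in> T" "b = below T le t" "finite F"
      "F \<subseteq> direct_succs T le t" "small b (pruned_cone T le t F)" "Nb b = pruned_cone T le t F"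
proof (cases "has_small_cone b")
  case True
  then show thesis
    using Nb[OF assms] cone by (auto simp: admissible_nbhd_def has_small_cone_def)
next
  case False
  then obtain t F where "t \<in> T" "b = below T le t" "admissible_pruning T le d \<epsilon> t F"
    "Nb b = pruned_cone T le t F"
    using Nb[OF assms] by (auto simp: admissible_nbhd_def has_small_cone_def)
  then show thesis
    using False by (intro pruned) (auto simp: admissible_pruning_def)
qed

text \<open>Both cases of the construction in one form, with \<open>F\<close> empty for a cone. The
  final disjunction records that a genuine pruning at \<open>t\<close> arises only from the branch
  \<open>b_t\<close>, so that only one pruned cone is chosen at each node.\<close>

lemma Nb_pruned_cone:
  assumes "b \<in> branches T le"
  obtains t F where "t \<in> T" "t \<in> b" "finite F" "F \<subseteq> direct_succs T le t" "b \<inter> F = {}"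
    "small b (Nb b)" "Nb b = pruned_cone T le t F" "F = {} \<or> b = below T le t"
  using assms
proof (cases rule: Nb_cases)
  case (cone s)
  then show thesis
    using that[of s "{}"] branch_subset[OF assms] by (auto simp: cone_eq_pruned_cone)
next
  case (pruned t F)
  then show thesis
    using that[of t F] below_mem_pruned_cone[of t F] by (auto simp: mem_pruned_cone)
qed

lemma self_mem_Nb:
  assumes "b \<in> branches T le"
  shows "b \<in> Nb b"
proof -
  obtain t F where "t \<in> b" "b \<inter> F = {}" "Nb b = pruned_cone T le t F"
    using Nb_pruned_cone[OF assms] by metis
  then show ?thesis
    using assms by (simp add: mem_pruned_cone)
qed

lemma small_Nb: "b \<in> branches T le \<Longrightarrow> small b (Nb b)"
  by (erule Nb_pruned_cone)

lemma clopen_Nb: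
  assumes "b \<in> branches T le"
  shows "openin X (Nb b)" "closedin X (Nb b)"
proof -
  obtain t F where "t \<in> T" "finite F" "F \<subseteq> direct_succs T le t" "Nb b = pruned_cone T le t F"
    using Nb_pruned_cone[OF assms] by metis
  moreover from this have "F \<subseteq> T"
    by (auto simp: direct_succs_def)
  ultimately show "openin X (Nb b)" "closedin X (Nb b)"
    using clopen_pruned_cone by auto
qed

lemma Nb_subset: "b \<in> branches T le \<Longrightarrow> Nb b \<subseteq> branches T le"
  using clopen_Nb(1) openin_subset topspace_tree_topology by blast

lemma rank_le_of_mem_Nb: "b \<in> branches T le \<Longrightarrow> c \<in> Nb b \<Longrightarrow> rank c \<le> rank b"
  using rank_le_of_small small_Nb clopen_Nb(1) by blast

text \<open>For distinct nodes this is laminarity of pruned cones. At a common node, either one of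
  the sets is the full cone and contains the other, or both are genuine prunings; then
  \<open>b\<close> = \<open>c\<close> and the sets coincide.\<close>

lemma Nb_laminar:
  assumes b: "b \<in> branches T le" and c: "c \<in> branches T le" and "Nb b \<inter> Nb c \<noteq> {}"
  shows "Nb b \<subseteq> Nb c \<or> Nb c \<subseteq> Nb b"
proof -
  obtain s F where F: "s \<in> T" "F \<subseteq> direct_succs T le s" "Nb b = pruned_cone T le s F"
    "F = {} \<or> b = below T le s"
    using Nb_pruned_cone[OF b] by metis
  obtain t G where G: "t \<in> T" "G \<subseteq> direct_succs T le t" "Nb c = pruned_cone T le t G"
    "G = {} \<or> c = below T le t"
    using Nb_pruned_cone[OF c] by metis
  show ?thesis
  proof (cases "s = t")
    case True
    then show ?thesis
      using F(3,4) G(3,4) by (auto simp: pruned_cone_def)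
  next
    case False
    then show ?thesis
      using pruned_cones_laminar[of s t F G] F G assms(3) by simp
  qed
qed

text \<open>A member containing \<open>N_b\<close> contains the branch \<open>b_t\<close>, so its
  node \<open>s\<close> lies in the finite set \<open>b_t\<close>. Each such \<open>s\<close>
  contributes at most its cone and the neighbourhood chosen for \<open>b_s\<close>.\<close>

lemma finite_Nb_supersets:
  assumes b: "b \<in> branches T le"
  shows "finite {M \<in> Nb ` branches T le. Nb b \<subseteq> M}"
proof -
  obtain t F where F: "t \<in> T" "F \<subseteq> direct_succs T le t" "Nb b = pruned_cone T le t F"
    using Nb_pruned_cone[OF b] by metis
  then have t: "below T le t \<in> Nb b"
    using below_mem_pruned_cone by simp
  have "{M \<in> Nb ` branches T le. Nb b \<subseteq> M} \<subseteq>
      cone T le ` below T le t \<union> (\<lambda>s. Nb (below T le s)) ` below T le t"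
  proof
    fix M
    assume "M \<in> {M \<in> Nb ` branches T le. Nb b \<subseteq> M}"
    then obtain c where c: "c \<in> branches T le" "M = Nb c" "below T le t \<in> M"
      using t by blast
    obtain s G where "Nb c = pruned_cone T le s G" "G = {} \<or> c = below T le s"
      using Nb_pruned_cone[OF c(1)] by metis
    then show "M \<in> cone T le ` below T le t \<union> (\<lambda>s. Nb (below T le s)) ` below T le t"
      using c by (auto simp: cone_eq_pruned_cone mem_pruned_cone)
  qed
  then show ?thesis
    using finite_below[OF F(1)] finite_subset by blast
qed

text \<open>Suppose N_b = U_s is a cone. Then \<open>s\<close> lies in \<open>c\<close>, and U_s is
  small at \<open>c\<close> by equality of ranks, so the least choice for \<open>c\<close> gives a
  cone containing U_s, contradicting strictness. Hence N_b is pruned at some \<open>t\<close>. If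
  N_c were pruned at \<open>u\<close>, the cone of the direct successor of \<open>t\<close> towards
  \<open>u\<close> would lie in N_b, hence be small at \<open>c\<close>, which excludes
  pruning.\<close>

lemma Nb_psubset:
  assumes b: "b \<in> branches T le" and c: "c \<in> branches T le" and "Nb c \<subset> Nb b" "rank c = rank b"
  shows "has_small_cone c" "\<not> has_small_cone b"
proof -
  have "c \<in> Nb b"
    using self_mem_Nb[OF c] assms(3) by blast
  have small_eq: "small c A = small b A" for A
    using assms(4) by (rule small_cong)
  show not_b: "\<not> has_small_cone b"
  proof
    assume "has_small_cone b"
    with b obtain s where s: "small b (cone T le s)" "Nb b = cone T le s"
      by (cases rule: Nb_cases) auto
    then have "s \<in> c"
      using \<open>c \<in> Nb b\<close> by (simp add: mem_cone)
    then have "has_small_cone c"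
      using s(1) small_eq by (auto simp: has_small_cone_def)
    with c obtain r where r: "r \<in> c" "\<And>s'. s' \<in> c \<Longrightarrow> small c (cone T le s') \<Longrightarrow> le r s'"
      "Nb c = cone T le r"
      by (cases rule: Nb_cases) auto
    then have "cone T le s \<subseteq> cone T le r"
      using \<open>s \<in> c\<close> s(1) small_eq branch_subset[OF c] by (intro cone_antimono) auto
    then show False
      using assms(3) s(2) r(3) by blast
  qed
  show "has_small_cone c"
  proof (rule ccontr)
    assume not_c: "\<not> has_small_cone c"
    obtain t F where F: "t \<in> T" "b = below T le t" "F \<subseteq> direct_succs T le t"
      "small b (pruned_cone T le t F)" "Nb b = pruned_cone T le t F"
      using b not_b by (cases rule: Nb_cases) auto
    obtain u where u: "u \<in> T" "c = below T le u"
      using c not_c by (cases rule: Nb_cases) auto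
    \<comment> \<open>If \<open>t\<close> = \<open>u\<close>, then \<open>b\<close> =
      \<open>c\<close>, against the strict inclusion.\<close>
    have "le t u" "t \<noteq> u"
      using \<open>c \<in> Nb b\<close> F(2,5) u assms(3) by (auto simp: mem_pruned_cone mem_below)
    then obtain r where r: "r \<in> direct_succs T le t" "le r u"
      using exists_direct_succ F(1) u(1) by blast
    then have "r \<in> c"
      using u by (auto simp: mem_below direct_succs_def)
    then have "r \<notin> F"
      using \<open>c \<in> Nb b\<close> F(5) by (auto simp: mem_pruned_cone)
    then have "small b (cone T le r)"
      by (rule small_mono[OF F(4) cone_subset_pruned_cone[OF r(1) F(3)]])
    then show False
      using not_c \<open>r \<in> c\<close> small_eq by (auto simp: has_small_cone_def)
  qed
qed

lemma laminar_family_Nb: "laminar_family (Nb ` branches T le)"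
proof (rule laminar_family.intro)
  show "{} \<notin> Nb ` branches T le"
    using self_mem_Nb by fastforce
  show "M \<subseteq> N \<or> N \<subseteq> M" if "M \<in> Nb ` branches T le" "N \<in> Nb ` branches T le" "M \<inter> N \<noteq> {}" for M N
    using that Nb_laminar by blast
  show "finite {M \<in> Nb ` branches T le. N \<subseteq> M}" if "N \<in> Nb ` branches T le" for N
    using that finite_Nb_supersets by blast
  fix \<B>
  assume \<B>: "\<B> \<subseteq> Nb ` branches T le" "\<B> \<noteq> {}"
  \<comment> \<open>The argument passes from sets to branches, because rank and
    \<open>has_small_cone\<close> are attached to \<open>b\<close> and not to the set
    \<open>N_b\<close>.\<close>
  define B where "B = {b \<in> branches T le. Nb b \<in> \<B>}"
  \<comment> \<open>Lexicographic: first the rank, then 0 for a cone and 1 for a pruned cone. A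
    strict inclusion of neighbourhoods lowers this pair.\<close>
  let ?r = "inv_image ({(\<alpha>, \<beta>). \<alpha> < \<beta>} <*lex*> less_than) (\<lambda>b. (rank b, if has_small_cone b then 0 else 1))"
  have "wf ?r"
    by (intro wf_inv_image wf_lex_prod wf_less_than wellorder_class.wf)
  moreover have "B \<noteq> {}"
    using \<B> by (auto simp: B_def)
  ultimately obtain b where b: "b \<in> B" "\<And>c. (c, b) \<in> ?r \<Longrightarrow> c \<notin> B"
    by (rule wfE_min') blast
  have "\<not> Nb c \<subset> Nb b" if "c \<in> B" for c
  proof
    assume psub: "Nb c \<subset> Nb b"
    have bc: "b \<in> branches T le" "c \<in> branches T le"
      using b(1) that by (auto simp: B_def)
    have "rank c \<le> rank b"
      using rank_le_of_mem_Nb[OF bc(1)] self_mem_Nb[OF bc(2)] psub by blast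
    then have "(c, b) \<in> ?r"
      using Nb_psubset[OF bc psub] by (auto simp: le_less)
    then show False
      using b(2) that by blast
  qed
  moreover have "\<B> = Nb ` B"
    using \<B>(1) by (auto simp: B_def)
  ultimately show "\<exists>M\<in>\<B>. \<forall>N\<in>\<B>. \<not> N \<subset> M"
    using b(1) by blast
qed

section \<open>Identification of q(b) with \<open>N_b\<close>\<close>

lemma Union_Nb: "\<Union>(Nb ` branches T le) = branches T le"
  using self_mem_Nb Nb_subset by blast

text \<open>Each of \<open>b\<close> and \<open>c\<close> lies in the neighbourhood of the other, so
  their ranks agree. A strict inclusion would make N_c a cone U_r and N_b a pruned cone at
  \<open>t\<close> with \<open>b\<close> = \<open>b_t\<close>. But \<open>b_t\<close> in U_r means
  that \<open>r\<close> lies below \<open>t\<close>, whence N_b \<subseteq> U_t \<subseteq>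
  N_c.\<close>

lemma Nb_eq_of_mem:
  assumes b: "b \<in> branches T le" and c: "c \<in> branches T le" and "b \<in> Nb c" "Nb c \<subseteq> Nb b"
  shows "Nb c = Nb b"
proof (rule ccontr)
  assume "Nb c \<noteq> Nb b"
  then have psub: "Nb c \<subset> Nb b"
    using assms(4) by blast
  have "rank c \<le> rank b" "rank b \<le> rank c"
    using rank_le_of_mem_Nb self_mem_Nb[OF c] assms by blast+
  then have "has_small_cone c" "\<not> has_small_cone b"
    using Nb_psubset[OF b c psub] by (meson order_antisym)+
  obtain r where r: "Nb c = cone T le r"
    using c \<open>has_small_cone c\<close> by (cases rule: Nb_cases) auto
  obtain t F where t: "b = below T le t" "Nb b = pruned_cone T le t F"
    using b \<open>\<not> has_small_cone b\<close> by (cases rule: Nb_cases) auto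
  have "cone T le t \<subseteq> cone T le r"
    using assms(3) r t(1) by (intro cone_antimono) (auto simp: mem_cone mem_below)
  then show False
    using psub r t(2) by (auto simp: pruned_cone_def)
qed

text \<open>The value q(b) is some N_c containing \<open>b\<close>, and it is contained in N_b
  because \<open>b\<close> lies in N_b; the previous lemma gives equality.\<close>

lemma residue_map_Nb:
  assumes b: "b \<in> branches T le"
  shows "residue_map (Nb ` branches T le) b = Nb b"
proof -
  interpret L: laminar_family "Nb ` branches T le"
    by (rule laminar_family_Nb)
  have bU: "b \<in> \<Union>(Nb ` branches T le)"
    using b Union_Nb by simp
  obtain c where c: "c \<in> branches T le" "residue_map (Nb ` branches T le) b = Nb c"
    using L.residue_map_mem(1)[OF bU] by blast
  have "b \<in> Nb c" "Nb c \<subseteq> Nb b"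
    using L.residue_map_subset_iff[OF bU] b c self_mem_Nb[OF b] by blast+
  then show ?thesis
    using Nb_eq_of_mem[OF b c(1)] c(2) by simp
qed

end

text \<open>The first two conjuncts give meaning to the others: well-foundedness justifies
  identifying nodes with branches in \<open>node_topology\<close>, and unique existence justifies
  the description operator in \<open>residue_map\<close>.\<close>

theorem proposition4p6:
  fixes T :: "'a set" and le :: "'a \<Rightarrow> 'a \<Rightarrow> bool"
    and d :: "'a set \<Rightarrow> 'a set \<Rightarrow> real" and \<epsilon> :: real
    and Nb :: "'a set \<Rightarrow> 'a set set" and \<N> :: "'a set set set"
  assumes "is_tree T le"
    and "finite (initial_nodes T le)"
    and "pseudometric_on (branches T le) d"
    and "fragmentable (tree_topology T le) d"
    and "\<epsilon> > 0"
    and "\<And>b. b \<in> branches T le \<Longrightarrow> admissible_nbhd T le d \<epsilon> b (Nb b)"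
    and "\<N> = Nb ` branches T le"
  shows "well_founded_tree \<N> contains \<and>
    (\<forall>b\<in>branches T le. \<exists>!M. M \<in> \<N> \<and> b \<in> residue \<N> M) \<and>
    residue_map \<N> ` branches T le = \<N> \<and>
    quotient_map (tree_topology T le) (node_topology \<N> contains) (residue_map \<N>)"
proof -
  interpret neighbourhood_family T le d \<epsilon> Nb
    using assms(1,4,5,6) by unfold_locales
  interpret L: laminar_family \<N>
    using laminar_family_Nb assms(7) by simp
  have U: "\<Union>\<N> = branches T le"
    using Union_Nb assms(7) by simp
  have onto: "residue_map \<N> ` branches T le = \<N>"
    unfolding assms(7) using residue_map_Nb by (intro image_cong) auto
  have "quotient_map (tree_topology T le) (node_topology \<N> contains) (residue_map \<N>)"
    using compact_tree_topology[OF assms(2)] U onto clopen_Nb assms(7)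
    by (intro L.quotient_map_residue_map) (auto simp: topspace_tree_topology)
  then show ?thesis
    using L.well_founded L.residue_ex1 U onto by simp
qed

end
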